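(* Let $A,B\in\mathbb{R}^{n\times n}$. The following conditions are equivalent: (i) the system $Ax+B|x|=b$ has a unique solution $x\in\mathbb{R}^n$ for each $b\in\mathbb{R}^n$; (ii) the system $Ax+B|x|=b$ has at most one solution $x\in\mathbb{R}^n$ for each $b\in\mathbb{R}^n$; (iii) the system $Ax+BD|x|=b$ has at least one solution $x\in\mathbb{R}^n$ for each $b\in\mathbb{R}^n$ and each $D\in\mathbb{R}^{n\times n}$ with $|D|=I_n$.
   Context: Absolute values of vectors and matrices are understood entrywise. $I_n$ is the $n\times n$ identity matrix; thus $|D|=I_n$ means that $D$ is a diagonal matrix with diagonal entries in $\{-1,1\}$. *)

theory Defs
  imports "HOL-Analysis.Analysis"
begin

end

theory Submission
  imports Defs
begin

text \<open>
  Call the pair \<open>(A, B)\<close> regular if \<open>A + B D\<close> is nonsingular for every diagonal \<open>D\<close> with entries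
  in the whole interval \<open>[-1, 1]\<close>. All three conditions are equivalent to regularity.

  The bridge to unique solvability is that the pairs \<open>(u - v, \<bar>u\<bar> - \<bar>v\<bar>)\<close> of real numbers are
  exactly the pairs \<open>(x, d x)\<close> with \<open>\<bar>d\<bar> \<le> 1\<close>. Hence two solutions of one system differ by a kernel
  vector of some \<open>A + B D\<close>, and conversely every kernel vector is such a difference: this is
  \<open>inj_abs_value_map_iff_regular\<close>.

  Uniqueness gives existence by topology: \<open>x \<mapsto> A x + B \<bar>x\<bar>\<close> is continuous and positively
  homogeneous, so if it is injective, its image is open by invariance of domain. The image is also
  a cone, and an open cone containing the origin is the whole space:
  see \<open>surj_abs_value_map_if_inj\<close>. Regularity of \<open>(A, B)\<close> passes to \<open>(A, B S)\<close> for each sign matrix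
  \<open>S\<close>, so all these systems are solvable.

  If regularity fails, some \<open>y \<noteq> 0\<close> satisfies \<open>y\<^sup>T (A + B D) = 0\<close>, so the entries of \<open>y\<^sup>T A\<close> are
  dominated by those of \<open>y\<^sup>T B\<close>. Giving the columns of \<open>B\<close> suitable signs \<open>S\<close> makes
  \<open>y\<^sup>T (A x + B S \<bar>x\<bar>)\<close> nonnegative for all \<open>x\<close>, and the right-hand side \<open>-y\<close> is out of reach:
  see \<open>regular_if_surj_signs\<close>.

  Diagonal matrices are represented by vectors acting through the entrywise product.
\<close>

section \<open>Regularity and injectivity\<close>

definition abs_value_map :: "real ^ 'n ^ 'm \<Rightarrow> real ^ 'n ^ 'm \<Rightarrow> real ^ 'n \<Rightarrow> real ^ 'm"
  where "abs_value_map A B x = A *v x + B *v \<bar>x\<bar>"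

definition regular_pair :: "real ^ 'n ^ 'm \<Rightarrow> real ^ 'n ^ 'm \<Rightarrow> bool"
  where "regular_pair A B \<longleftrightarrow>
    (\<forall>d x. (\<forall>i. \<bar>d $ i\<bar> \<le> 1) \<longrightarrow> A *v x + B *v (d * x) = 0 \<longrightarrow> x = 0)"

lemma abs_diff_eq_scaled_diff:
  fixes u v :: "real ^ 'n"
  obtains d :: "real ^ 'n" where "\<And>i. \<bar>d $ i\<bar> \<le> 1" and "\<bar>u\<bar> - \<bar>v\<bar> = d * (u - v)"
proof
  \<comment> \<open>Where \<open>u\<close> and \<open>v\<close> agree, the quotient is \<open>0 / 0 = 0\<close>, which is an admissible entry.\<close>
  let ?d = "\<chi> i. (\<bar>u $ i\<bar> - \<bar>v $ i\<bar>) / (u $ i - v $ i)"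
  show "\<bar>?d $ i\<bar> \<le> 1" for i
    using abs_triangle_ineq3[of "u $ i" "v $ i"] by (simp add: divide_le_eq_1)
  show "\<bar>u\<bar> - \<bar>v\<bar> = ?d * (u - v)"
    by (simp add: vec_eq_iff abs_vec_def)
qed

text \<open>
  For a single entry, the translates \<open>u = v + x\<close> make \<open>\<bar>u\<bar> - \<bar>v\<bar>\<close> run through
  \<open>[-\<bar>x\<bar>, \<bar>x\<bar>]\<close>. The value \<open>d x\<close> is attained when \<open>u\<close> and \<open>v\<close> have opposite signs,
  where \<open>\<bar>u\<bar> - \<bar>v\<bar>\<close> equals \<open>u + v\<close> up to the sign of \<open>x\<close>; solving for \<open>u\<close> and \<open>v\<close> gives the
  witnesses.
\<close>
lemma scaled_eq_abs_diff:
  fixes d x :: "real ^ 'n"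
  assumes "\<And>i. \<bar>d $ i\<bar> \<le> 1"
  obtains u v :: "real ^ 'n" where "u - v = x" and "\<bar>u\<bar> - \<bar>v\<bar> = d * x"
proof
  let ?u = "\<chi> i. (d $ i * \<bar>x $ i\<bar> + x $ i) / 2" and ?v = "\<chi> i. (d $ i * \<bar>x $ i\<bar> - x $ i) / 2"
  show "?u - ?v = x"
    by (simp add: vec_eq_iff field_simps)
  have "\<bar>?u $ i\<bar> - \<bar>?v $ i\<bar> = d $ i * x $ i" for i
  proof -
    have "\<bar>d $ i * \<bar>x $ i\<bar>\<bar> \<le> \<bar>x $ i\<bar>"
      using assms[of i] by (simp add: abs_mult mult_left_le_one_le)
    then show ?thesis
      by (cases "x $ i \<ge> 0") (auto simp: field_simps)
  qed
  then show "\<bar>?u\<bar> - \<bar>?v\<bar> = d * x"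
    by (simp add: vec_eq_iff abs_vec_def)
qed

lemma inj_abs_value_map_iff_regular:
  "inj (abs_value_map A B) \<longleftrightarrow> regular_pair A B"
proof
  assume inj: "inj (abs_value_map A B)"
  show "regular_pair A B"
    unfolding regular_pair_def
  proof (intro allI impI)
    fix d x
    assume d: "\<forall>i. \<bar>d $ i\<bar> \<le> 1" and ker: "A *v x + B *v (d * x) = 0"
    obtain u v where uv: "u - v = x" "\<bar>u\<bar> - \<bar>v\<bar> = d * x"
      using scaled_eq_abs_diff[of d x] d by blast
    have "abs_value_map A B u - abs_value_map A B v = A *v (u - v) + B *v (\<bar>u\<bar> - \<bar>v\<bar>)"
      by (simp add: abs_value_map_def matrix_vector_mult_diff_distrib)
    then have "abs_value_map A B u = abs_value_map A B v"
      using ker uv by simp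
    then show "x = 0"
      using inj uv(1) by (simp add: inj_eq)
  qed
next
  assume reg: "regular_pair A B"
  show "inj (abs_value_map A B)"
  proof (rule injI)
    fix u v
    assume eq: "abs_value_map A B u = abs_value_map A B v"
    obtain d where d: "\<And>i. \<bar>d $ i\<bar> \<le> 1" "\<bar>u\<bar> - \<bar>v\<bar> = d * (u - v)"
      using abs_diff_eq_scaled_diff[of u v] by blast
    have "A *v (u - v) + B *v (d * (u - v)) = abs_value_map A B u - abs_value_map A B v"
      by (simp add: abs_value_map_def matrix_vector_mult_diff_distrib flip: d(2))
    then have "u - v = 0"
      using reg d(1) eq unfolding regular_pair_def by (metis diff_self)
    then show "u = v"
      by simp
  qed
qed

section \<open>Injectivity implies surjectivity\<close>

lemma continuous_on_abs_value_map:
  fixes A B :: "real ^ 'n ^ 'm"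
  shows "continuous_on S (abs_value_map A B)"
proof -
  have "continuous_on S (\<lambda>x :: real ^ 'n. \<chi> i. \<bar>x $ i\<bar>)"
    by (intro continuous_intros)
  then show ?thesis
    unfolding abs_value_map_def abs_vec_def
    by (intro continuous_on_add continuous_on_id
        bounded_linear.continuous_on[OF matrix_vector_mul_bounded_linear])
qed

lemma abs_value_map_scaleR:
  assumes "c \<ge> 0"
  shows "abs_value_map A B (c *\<^sub>R x) = c *\<^sub>R abs_value_map A B x"
proof -
  have "\<bar>c *\<^sub>R x\<bar> = c *\<^sub>R \<bar>x\<bar>"
    using assms by (simp add: vec_eq_iff abs_vec_def abs_mult)
  then show ?thesis
    by (simp add: abs_value_map_def matrix_vector_mult_scaleR scaleR_add_right)
qed

text \<open>
  Invariance of domain makes the image open. It contains the value \<open>0\<close> at the origin, hence a ball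
  around it, and positive homogeneity spreads this ball over the space.
\<close>
lemma surj_abs_value_map_if_inj:
  fixes A B :: "real ^ 'n ^ 'n"
  assumes "inj (abs_value_map A B)"
  shows "surj (abs_value_map A B)"
proof -
  have "open (range (abs_value_map A B))"
    using assms by (intro invariance_of_domain continuous_on_abs_value_map) auto
  moreover have "0 \<in> range (abs_value_map A B)"
    using abs_value_map_scaleR[of 0 A B 0] by (metis order_refl rangeI scaleR_zero_left)
  ultimately obtain e where e: "e > 0" "cball 0 e \<subseteq> range (abs_value_map A B)"
    by (meson open_contains_cball)
  have "b \<in> range (abs_value_map A B)" for b
  proof (cases "b = 0")
    case True
    then show ?thesis
      using \<open>0 \<in> range (abs_value_map A B)\<close> by simp
  next
    case False
    have "(e / norm b) *\<^sub>R b \<in> cball 0 e"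
      using False e(1) by simp
    then obtain x where "abs_value_map A B x = (e / norm b) *\<^sub>R b"
      using e(2) by (metis rangeE subsetD)
    then have "abs_value_map A B ((norm b / e) *\<^sub>R x) = b"
      using False e(1) by (simp add: abs_value_map_scaleR)
    then show ?thesis
      by (metis rangeI)
  qed
  then show ?thesis
    by blast
qed

section \<open>Sign changes and surjectivity\<close>

lemma abs_eq_mat_1_mult_vec:
  fixes S :: "real ^ 'n ^ 'n"
  assumes "\<bar>S\<bar> = mat 1"
  shows "S *v x = (\<chi> i. S $ i $ i) * x" and "\<bar>S $ i $ i\<bar> = 1"
proof -
  have entry: "\<bar>S $ i $ j\<bar> = (if i = j then 1 else 0)" for i j
    using assms by (simp add: vec_eq_iff abs_vec_def mat_def)
  show "\<bar>S $ i $ i\<bar> = 1"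
    using entry[of i i] by simp
  have "(S *v x) $ i = S $ i $ i * x $ i" for i
  proof -
    have "(S *v x) $ i = (\<Sum>j\<in>UNIV. if j = i then S $ i $ i * x $ i else 0)"
      unfolding matrix_vector_mult_def vec_lambda_beta
    proof (rule sum.cong)
      show "S $ i $ j * x $ j = (if j = i then S $ i $ i * x $ i else 0)" for j
        using entry[of i j] by auto
    qed simp
    then show ?thesis
      by simp
  qed
  then show "S *v x = (\<chi> i. S $ i $ i) * x"
    by (simp add: vec_eq_iff)
qed

lemma regular_pair_sign_change:
  fixes A B :: "real ^ 'n ^ 'n"
  assumes "regular_pair A B" and "\<bar>S\<bar> = mat 1"
  shows "regular_pair A (B ** S)"
  unfolding regular_pair_def
proof (intro allI impI)
  fix d x
  assume d: "\<forall>i. \<bar>d $ i\<bar> \<le> 1" and ker: "A *v x + (B ** S) *v (d * x) = 0"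
  let ?d = "(\<chi> i. S $ i $ i) * d"
  have "\<forall>i. \<bar>?d $ i\<bar> \<le> 1"
    using d abs_eq_mat_1_mult_vec(2)[OF assms(2)] by (simp add: abs_mult)
  moreover have "A *v x + B *v (?d * x) = 0"
    using ker abs_eq_mat_1_mult_vec(1)[OF assms(2)]
    by (simp add: matrix_vector_mul_assoc[symmetric] mult.assoc)
  ultimately show "x = 0"
    using assms(1) unfolding regular_pair_def by blast
qed

text \<open>
  A singular \<open>A + B D\<close> has a left null vector \<open>y\<close>, so that the entries \<open>p\<close> of \<open>y\<^sup>T A\<close> and \<open>q\<close> of
  \<open>y\<^sup>T B\<close> satisfy \<open>p i = - q i * d i\<close>. For signs with \<open>s i * q i = \<bar>q i\<bar>\<close>, the inner product of \<open>y\<close>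
  with \<open>A x + B S \<bar>x\<bar>\<close> is at least the sum of \<open>(\<bar>q i\<bar> - \<bar>p i\<bar>) \<bar>x i\<bar>\<close>, which is nonnegative,
  so the value \<open>-y\<close> is not attained.
\<close>
lemma regular_if_surj_signs:
  fixes A B :: "real ^ 'n ^ 'n"
  assumes surj: "\<And>S. \<bar>S\<bar> = mat 1 \<Longrightarrow> surj (abs_value_map A (B ** S))"
  shows "regular_pair A B"
  unfolding regular_pair_def
proof (intro allI impI, rule ccontr)
  fix d z
  assume d: "\<forall>i. \<bar>d $ i\<bar> \<le> 1" and ker: "A *v z + B *v (d * z) = 0" and "z \<noteq> 0"
  let ?L = "\<lambda>x. A *v x + B *v (d * x)"
  have "d * (c *\<^sub>R x) = c *\<^sub>R (d * x)" for c :: real and x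
    by (simp add: vec_eq_iff)
  then have lin: "linear ?L"
    by (intro linearI) (simp_all add: distrib_left matrix_vector_right_distrib
        matrix_vector_mult_scaleR scaleR_add_right)
  have "\<not> inj ?L"
    using ker \<open>z \<noteq> 0\<close> lin by (auto simp: linear_injective_0)
  then have "range ?L \<noteq> UNIV"
    using linear_surjective_imp_injective[OF lin] by blast
  then have "span (range ?L) \<noteq> UNIV"
    by (simp add: span_eq_iff[THEN iffD2] linear_subspace_image[OF lin])
  then obtain y where "y \<noteq> 0" and "\<forall>v \<in> span (range ?L). y \<bullet> v = 0"
    using span_not_UNIV_orthogonal[of "range ?L"] by blast
  then have y: "y \<bullet> ?L x = 0" for x
    using span_base[OF rangeI[of ?L x]] by blast
  define p where "p = y v* A"
  define q where "q = y v* B"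
  have inner_A: "y \<bullet> (A *v x) = p \<bullet> x" and inner_B: "y \<bullet> (B *v x) = q \<bullet> x" for x
    by (simp_all add: p_def q_def dot_lmul_matrix)
  have p_le_q: "\<bar>p $ i\<bar> \<le> \<bar>q $ i\<bar>" for i
  proof -
    have "d * axis i 1 = axis i (d $ i)"
      by (simp add: vec_eq_iff axis_def)
    then have "p $ i + q $ i * d $ i = 0"
      using y[of "axis i 1"] by (simp add: inner_add_right inner_A inner_B inner_axis)
    then have "\<bar>p $ i\<bar> = \<bar>q $ i\<bar> * \<bar>d $ i\<bar>"
      by (metis abs_minus_cancel abs_mult eq_neg_iff_add_eq_0)
    then show ?thesis
      using d by (simp add: mult_left_le)
  qed
  define S :: "real ^ 'n ^ 'n"
    where "S = (\<chi> i j. if i = j then (if q $ i \<ge> 0 then 1 else - 1) else 0)"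
  have S: "\<bar>S\<bar> = mat 1"
    by (simp add: vec_eq_iff abs_vec_def mat_def S_def)
  obtain x where x: "abs_value_map A (B ** S) x = - y"
    using surj[OF S] by (metis surjD)
  have "y \<bullet> abs_value_map A (B ** S) x = p \<bullet> x + q \<bullet> (S *v \<bar>x\<bar>)"
    by (simp add: abs_value_map_def inner_add_right inner_A inner_B
        flip: matrix_vector_mul_assoc)
  also have "\<dots> = (\<Sum>i\<in>UNIV. p $ i * x $ i + \<bar>q $ i\<bar> * \<bar>x $ i\<bar>)"
    unfolding abs_eq_mat_1_mult_vec(1)[OF S] inner_vec_def
    by (simp add: S_def abs_vec_def flip: sum.distrib) (intro sum.cong, auto)
  also have "\<dots> \<ge> 0"
  proof (rule sum_nonneg)
    fix i
    have "\<bar>p $ i * x $ i\<bar> \<le> \<bar>q $ i\<bar> * \<bar>x $ i\<bar>"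
      using p_le_q[of i] by (simp add: abs_mult mult_right_mono)
    then show "0 \<le> p $ i * x $ i + \<bar>q $ i\<bar> * \<bar>x $ i\<bar>"
      by linarith
  qed
  finally have "y \<bullet> y \<le> 0"
    by (simp add: x)
  then show False
    using \<open>y \<noteq> 0\<close> by (simp flip: not_less)
qed

section \<open>The three equivalent conditions\<close>

theorem theorem7:
  fixes A B :: "real ^ 'n ^ 'n"
  shows "((\<forall>b :: real ^ 'n. \<exists>!x :: real ^ 'n. A *v x + B *v \<bar>x\<bar> = b) \<longleftrightarrow>
          (\<forall>b :: real ^ 'n. \<exists>\<^sub>\<le>\<^sub>1x :: real ^ 'n. A *v x + B *v \<bar>x\<bar> = b)) \<and>
         ((\<forall>b :: real ^ 'n. \<exists>\<^sub>\<le>\<^sub>1x :: real ^ 'n. A *v x + B *v \<bar>x\<bar> = b) \<longleftrightarrow>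
          (\<forall>(b :: real ^ 'n) (D :: real ^ 'n ^ 'n). \<bar>D\<bar> = mat 1 \<longrightarrow>
             (\<exists>x :: real ^ 'n. A *v x + (B ** D) *v \<bar>x\<bar> = b)))"
proof -
  have unique: "(\<forall>b. \<exists>!x. A *v x + B *v \<bar>x\<bar> = b) \<longleftrightarrow> bij (abs_value_map A B)"
    by (simp add: bij_iff abs_value_map_def)
  have at_most_one: "(\<forall>b. \<exists>\<^sub>\<le>\<^sub>1x. A *v x + B *v \<bar>x\<bar> = b) \<longleftrightarrow> inj (abs_value_map A B)"
    by (auto simp: Uniq_def inj_def abs_value_map_def)
  have solvable: "(\<forall>b D. \<bar>D\<bar> = mat 1 \<longrightarrow> (\<exists>x. A *v x + (B ** D) *v \<bar>x\<bar> = b)) \<longleftrightarrow>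
      (\<forall>D. \<bar>D\<bar> = mat 1 \<longrightarrow> surj (abs_value_map A (B ** D)))"
    unfolding surj_def abs_value_map_def by (subst eq_commute) blast
  have "bij (abs_value_map A B) \<longleftrightarrow> inj (abs_value_map A B)"
    using surj_abs_value_map_if_inj by (auto simp: bij_def)
  moreover have "inj (abs_value_map A B) \<longleftrightarrow>
      (\<forall>D. \<bar>D\<bar> = mat 1 \<longrightarrow> surj (abs_value_map A (B ** D)))"
    unfolding inj_abs_value_map_iff_regular
  proof (intro iffI allI impI)
    fix D :: "real ^ 'n ^ 'n"
    assume "regular_pair A B" and "\<bar>D\<bar> = mat 1"
    then have "inj (abs_value_map A (B ** D))"
      by (simp add: regular_pair_sign_change inj_abs_value_map_iff_regular)
    then show "surj (abs_value_map A (B ** D))"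
      by (rule surj_abs_value_map_if_inj)
  qed (simp add: regular_if_surj_signs)
  ultimately show ?thesis
    unfolding unique at_most_one solvable by blast
qed

end
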